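(* Let $N\ge 1$ and let $\lambda_1,\dots,\lambda_N>0$. Put $a_k^*:=2/\lambda_k$ and, for $\tilde T>0$, let $$a_k(t;\tilde T):=2\,\frac{1+(\tilde T-1)e^{-2\lambda_kt}}{\lambda_k},\qquad t\ge 0,\ k=1,\dots,N,$$ which is the solution of $\dot a_k=-2\lambda_k(a_k-a_k^* )$ with $a_k(0)=2\tilde T/\lambda_k$. Let $$F(a_1,\dots,a_N):=\sum_{k=1}^N\lambda_k\left(\frac{a_k^*}{a_k}-\ln\left(\frac{a_k^*}{a_k}\right)-1\right),\qquad a_1,\dots,a_N>0.$$ Let $0<\tilde T^-<1<\tilde T^+$ and set $a^\pm(t):=(a_1(t;\tilde T^\pm),\dots,a_N(t;\tilde T^\pm))$. If the initial conditions are $F$-equidistant, i.e. $F(a^+(0))=F(a^-(0))$, then the curve starting below the equilibrium temperature is faster than the one starting above it, i.e. $$F(a^-(t))\le F(a^+(t))\qquad\text{for all } t\ge 0 .$$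
   Context: This describes Gaussian chains ($N+1$ beads connected by ideal springs with zero rest length): $a_k$ is the variance of the $k$-th normal mode (a zero-mean Gaussian), $\lambda_k$ are the eigenvalues associated with the independent modes, and $\tilde T$ is the ratio of the initial temperature to the equilibrium temperature. $\tilde T<1$ corresponds to warming up and $\tilde T>1$ to cooling down. The function $F$ has its global minimum, with value $0$, at $(a_1^*,\dots,a_N^* )$ and is used as the measure of distance to equilibrium. *)

theory Defs imports Complex_Main begin

text \<open>A tuple indexed by $k = 1, \dots, N$ is a function on \<^typ>\<open>nat\<close>; only its values on
  \<^term>\<open>{1..N}\<close> are used.\<close>

definition a_eq :: "(nat \<Rightarrow> real) \<Rightarrow> nat \<Rightarrow> real" where
  "a_eq lam k = 2 / lam k"

definition a_sol :: "(nat \<Rightarrow> real) \<Rightarrow> real \<Rightarrow> real \<Rightarrow> nat \<Rightarrow> real" where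
  "a_sol lam T t k = 2 * ((1 + (T - 1) * exp (- 2 * lam k * t)) / lam k)"

lemma a_sol_0: "a_sol lam T 0 k = 2 * T / lam k"
  by (simp add: a_sol_def)

lemma a_sol_ode:
  assumes "lam k > 0"
  shows "((\<lambda>t. a_sol lam T t k) has_real_derivative
           - 2 * lam k * (a_sol lam T t k - a_eq lam k)) (at t)"
  unfolding a_sol_def a_eq_def using assms
  by (auto intro!: derivative_eq_intros simp: field_simps)

lemma a_sol_pos:
  assumes "lam k > 0" "T > 0" "t \<ge> 0"
  shows "a_sol lam T t k > 0"
proof -
  define s where "s = exp (- 2 * lam k * t)"
  have s: "0 < s" "s \<le> 1" using assms by (auto simp: s_def)
  have "1 + (T - 1) * s = (1 - s) + T * s" by (simp add: algebra_simps)
  also have "\<dots> > 0" using s assms by (simp add: add_nonneg_pos)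
  finally show ?thesis using assms by (simp add: a_sol_def s_def)
qed

text \<open>The functional is meant for arguments that are positive on \<^term>\<open>{1..N}\<close>;
  by \<open>a_sol_pos\<close> the curves stay in this domain.\<close>

definition F :: "nat \<Rightarrow> (nat \<Rightarrow> real) \<Rightarrow> (nat \<Rightarrow> real) \<Rightarrow> real" where
  "F N lam a = (\<Sum>k = 1..N. lam k * (a_eq lam k / a k - ln (a_eq lam k / a k) - 1))"

end

(* Put s = exp (-2 lam_k t), p = Tplus - 1, q = 1 - Tminus and g x = 1/(1+x) + ln (1+x) - 1.
   The k-th summands of F along the two curves are lam_k g(p s) and lam_k g(-q s), and
   equidistance says g p = g(-q). So h s = g(p s) - g(-q s) vanishes at s = 0 and s = 1.
   As g' x = x/(1+x)^2, the sign of h' s is that of p/(1+p s) - q/(1-q s), i.e. of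
   p - q - 2 p q s, which changes at most once, from + to -. Hence h >= 0 on [0,1], and the
   inequality even holds mode by mode. *)
theory Submission imports Defs begin

text \<open>The variable \<open>x\<close> is the relative deviation of a variance from equilibrium:
  with \<open>a = (1 + x) * a_eq lam k\<close>, the bracket in \<open>F\<close> becomes this
  function.\<close>

definition mode_excess :: "real \<Rightarrow> real" where
  "mode_excess x = 1 / (1 + x) + ln (1 + x) - 1"

lemma mode_excess_deriv:
  assumes "1 + x > 0"
  shows "(mode_excess has_real_derivative x / (1 + x)\<^sup>2) (at x)"
proof -
  have "(mode_excess has_real_derivative - 1 / (1 + x)\<^sup>2 + 1 / (1 + x)) (at x)"
    unfolding mode_excess_def using assms
    by (auto intro!: derivative_eq_intros simp: power2_eq_square)
  moreover have "- 1 / (1 + x)\<^sup>2 + 1 / (1 + x) = x / (1 + x)\<^sup>2"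
    using assms by (simp add: divide_simps power2_eq_square)
  ultimately show ?thesis by simp
qed

text \<open>A negative value of \<open>h\<close> between its zeros 0 and 1 would force
  \<open>h'\<close> to be negative somewhere and positive later, in the wrong order for its only
  possible sign change.\<close>

lemma mode_excess_mono_scaled:
  fixes p q s :: real
  assumes p: "0 < p" and q: "0 < q" "q < 1" and s: "0 \<le> s" "s \<le> 1"
    and eq: "mode_excess p = mode_excess (- q)"
  shows "mode_excess (- (q * s)) \<le> mode_excess (p * s)"
proof (rule ccontr)
  define h where "h u = mode_excess (p * u) - mode_excess (- (q * u))" for u
  define h' where "h' u = p\<^sup>2 * u / (1 + p * u)\<^sup>2 - q\<^sup>2 * u / (1 - q * u)\<^sup>2" for u
  have pos: "1 + p * u > 0" "1 - q * u > 0" if "0 \<le> u" "u \<le> 1" for u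
  proof -
    show "1 + p * u > 0" using p that by (simp add: add_pos_nonneg)
    have "q * u \<le> q" using q that by (simp add: mult_left_le)
    then show "1 - q * u > 0" using q by linarith
  qed
  have deriv: "(h has_real_derivative h' u) (at u)" if "0 \<le> u" "u \<le> 1" for u
  proof -
    have "((\<lambda>u. mode_excess (p * u)) has_real_derivative p * u / (1 + p * u)\<^sup>2 * p) (at u)"
      by (rule DERIV_chain2[OF mode_excess_deriv])
         (use pos[OF that] in \<open>auto intro!: derivative_eq_intros\<close>)
    moreover have "((\<lambda>u. mode_excess (- (q * u))) has_real_derivative
        - (q * u) / (1 + - (q * u))\<^sup>2 * (- q)) (at u)"
      by (rule DERIV_chain2[OF mode_excess_deriv])
         (use pos[OF that] in \<open>auto intro!: derivative_eq_intros\<close>)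
    ultimately have "(h has_real_derivative
        p * u / (1 + p * u)\<^sup>2 * p - - (q * u) / (1 + - (q * u))\<^sup>2 * (- q)) (at u)"
      unfolding h_def by (rule DERIV_diff)
    then show ?thesis by (simp add: h'_def power2_eq_square mult_ac)
  qed
  have sign: "(0 < h' u) = (2 * p * q * u < p - q)" "(h' u < 0) = (p - q < 2 * p * q * u)"
    if "0 < u" "u \<le> 1" for u
  proof -
    \<comment> \<open>Up to the factor \<open>u\<close>, the two terms of \<open>h' u\<close> are
      the squares of \<open>x\<close> and \<open>y\<close>. Both are positive, so comparing squares
      reduces to comparing \<open>x\<close> and \<open>y\<close>, and clearing denominators leaves a
      condition linear in \<open>u\<close>.\<close>
    define x where "x = p / (1 + p * u)"
    define y where "y = q / (1 - q * u)"
    have d: "1 + p * u > 0" "1 - q * u > 0" using pos[of u] that by auto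
    have xy: "0 < x" "0 < y" using d p q by (auto simp: x_def y_def)
    have h': "h' u = u * (x\<^sup>2 - y\<^sup>2)"
      by (simp add: h'_def x_def y_def power_divide algebra_simps)
    have "(0 < h' u) = (y\<^sup>2 < x\<^sup>2)" "(h' u < 0) = (x\<^sup>2 < y\<^sup>2)"
      using that by (auto simp: h' zero_less_mult_iff mult_less_0_iff)
    then have "(0 < h' u) = (y < x)" "(h' u < 0) = (x < y)"
      using xy by (auto simp: power_mono_iff less_le)
    moreover have "(y < x) = (2 * p * q * u < p - q)" "(x < y) = (p - q < 2 * p * q * u)"
      unfolding x_def y_def using d
      by (auto simp: pos_divide_less_eq pos_less_divide_eq) (auto simp: field_simps)
    ultimately show "(0 < h' u) = (2 * p * q * u < p - q)"
      "(h' u < 0) = (p - q < 2 * p * q * u)" by auto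
  qed
  assume "\<not> ?thesis"
  then have neg: "h s < 0" by (simp add: h_def)
  have h0: "h 0 = 0" and h1: "h 1 = 0" by (simp_all add: h_def eq)
  have "s \<noteq> 0" "s \<noteq> 1" using neg h0 h1 by auto
  with s have s': "0 < s" "s < 1" by auto
  \<comment> \<open>The graph of \<open>h\<close> descends from 0 to \<open>h s\<close> and climbs
    back to 0, which yields a negative slope at \<open>v\<close> and a positive one at
    \<open>w\<close>.\<close>
  obtain v where v: "0 < v" "v < s" "h s - h 0 = (s - 0) * h' v"
    using MVT2[of 0 s h h'] deriv s' by auto
  obtain w where w: "s < w" "w < 1" "h 1 - h s = (1 - s) * h' w"
    using MVT2[of s 1 h h'] deriv s' by auto
  have "h' v < 0" using v h0 neg s' by (simp add: mult_less_0_iff)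
  then have "p - q < 2 * p * q * v" using sign v s' by auto
  \<comment> \<open>Since \<open>v < s < w\<close>, the negative sign persists at
    \<open>w\<close>.\<close>
  also have "\<dots> < 2 * p * q * w" using p q v w by simp
  finally have "p - q < 2 * p * q * w" .
  moreover have "0 < (1 - s) * h' w" using w h1 neg by linarith
  then have "h' w > 0" using s' by (simp add: zero_less_mult_iff)
  ultimately show False using sign[of w] w s' by auto
qed

text \<open>Along the solution \<open>a_eq lam k / a_sol lam T t k\<close> is the reciprocal of
  \<open>b\<close>, so minus its logarithm is \<open>ln b\<close>.\<close>

lemma F_a_sol:
  assumes lam: "\<And>k. k \<in> {1..N} \<Longrightarrow> lam k > 0" and T: "T > 0" and t: "t \<ge> 0"
  shows "F N lam (a_sol lam T t) =
    (\<Sum>k = 1..N. lam k * mode_excess ((T - 1) * exp (- 2 * lam k * t)))"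
  unfolding F_def
proof (rule sum.cong)
  fix k assume k: "k \<in> {1..N}"
  define b where "b = 1 + (T - 1) * exp (- 2 * lam k * t)"
  have sol: "a_sol lam T t k = 2 * (b / lam k)" by (simp add: a_sol_def b_def)
  have "b > 0"
    using a_sol_pos[of lam k T t] T t lam[OF k] by (simp add: sol zero_less_divide_iff)
  moreover have "a_eq lam k / a_sol lam T t k = 1 / b"
    using lam[OF k] by (simp add: a_eq_def sol)
  ultimately show "lam k * (a_eq lam k / a_sol lam T t k - ln (a_eq lam k / a_sol lam T t k) - 1)
      = lam k * mode_excess ((T - 1) * exp (- 2 * lam k * t))"
    unfolding mode_excess_def b_def[symmetric] by (simp add: ln_div)
qed simp

theorem mainTheorem3:
  fixes N :: nat and lam :: "nat \<Rightarrow> real" and Tminus Tplus :: real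
  assumes "N \<ge> 1"
    and "\<And>k. k \<in> {1..N} \<Longrightarrow> lam k > 0"
    and "0 < Tminus" and "Tminus < 1" and "1 < Tplus"
    and "F N lam (a_sol lam Tplus 0) = F N lam (a_sol lam Tminus 0)"
  shows "\<forall>t\<ge>0. F N lam (a_sol lam Tminus t) \<le> F N lam (a_sol lam Tplus t)"
proof (intro allI impI)
  fix t :: real assume t: "t \<ge> 0"
  \<comment> \<open>At time 0 all modes share the deviation \<open>T - 1\<close>, so equidistance of
    the sums becomes equidistance in a single mode once the positive total of the
    \<open>lam k\<close> is cancelled.\<close>
  have F0: "F N lam (a_sol lam T 0) = (\<Sum>k = 1..N. lam k) * mode_excess (T - 1)"
    if "T > 0" for T
    using F_a_sol[OF assms(2) that order.refl] by (simp add: sum_distrib_right)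
  have "(\<Sum>k = 1..N. lam k) > 0" using assms(1,2) by (intro sum_pos) auto
  then have eq: "mode_excess (Tplus - 1) = mode_excess (- (1 - Tminus))"
    using assms(3-6) by (simp add: F0)
  \<comment> \<open>Each mode has its own scaling factor in (0,1], but the same equality
    \<open>eq\<close> serves them all.\<close>
  have mode: "mode_excess ((Tminus - 1) * exp (- 2 * lam k * t))
      \<le> mode_excess ((Tplus - 1) * exp (- 2 * lam k * t))" if "k \<in> {1..N}" for k
    using mode_excess_mono_scaled[OF _ _ _ _ _ eq, of "exp (- 2 * lam k * t)"]
      assms(2)[OF that] assms(3-5) t by (simp add: algebra_simps)
  have Ft: "F N lam (a_sol lam T t) =
      (\<Sum>k = 1..N. lam k * mode_excess ((T - 1) * exp (- 2 * lam k * t)))" if "T > 0" for T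
    by (rule F_a_sol) (use assms(2) that t in auto)
  have "Tplus > 0" using assms(5) by simp
  show "F N lam (a_sol lam Tminus t) \<le> F N lam (a_sol lam Tplus t)"
    unfolding Ft[OF assms(3)] Ft[OF \<open>Tplus > 0\<close>]
    by (intro sum_mono mult_left_mono mode less_imp_le[OF assms(2)])
qed

end
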